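(* Let $(D,P)$ be an ordered unoriented even $r$-component virtual link diagram with a cut system $P$, $D=D^1\cup\dots\cup D^r$ with $D^i$ the components of $D$, and let $\mathcal{O}_c(D,P)$ be a cut orientation of $(D,P)$. Let $i\neq j$ and $k\in\{1,2\}$. Then the absolute value of the sum of the signs of those classical crossings between $D^i_k$ and $D^j_1\cup D^j_2$ whose overpasses are in $D^i_k$, in the coherent double covering diagram $\phi_{\mathcal{O}_c(D,P)}(D,P)$ with the cut orientation $\mathcal{O}_c(D,P)$, coincides with $|\nu_D(i,j)|$.
   Context: A virtual link diagram is a generically immersed closed 1-manifold in $\mathbb{R}^2$ each of whose double points is either a classical crossing, with over/under information, or a virtual crossing, without over/under information. It is even if every component passes through classical crossings an even number of times (counting over- and underpasses, i.e. each circle of its Gauss diagram carries an even number of chord endpoints). Ordered means the components are numbered. Cut systems. Let $P$ be a finite set of points on the edges of $D$ (away from crossings). The abstract link diagram (ALD) associated with $(D,P)$ is the pair $(\Sigma,D_\Sigma)$ where $\Sigma$ is the compact surface obtained by thickening $D$: a disk at each classical crossing, bands along the edges, the two bands at a virtual crossing passing each other disjointly, and a half twist inserted in the band at each point of $P$; $D_\Sigma$ is the core diagram. $P$ is a cut system of $D$ if the regions of $\Sigma-|D_\Sigma|$ can be colored black and white so that adjacent regions have different colors. Equivalently, the segments of $D$ between consecutive classical crossings and points of $P$ can be oriented (passing straight through virtual crossings) so that at each classical crossing each of the two strands reverses orientation, one strand having both its ends directed into the crossing and the other having both its ends directed out of it, and at each point of $P$ the orientation reverses. A cut orientation $\mathcal{O}_c(D,P)$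 is a choice of orientation of each arc of $D$ cut along $P$ such that the orientation switches to the opposite direction at each cut point (and is not switched at classical or virtual crossings). It exists for even $D$, since each component then carries an even number of cut points. $\nu_{(D,P)}(i,j)$ is the sum, with respect to $\mathcal{O}_c(D,P)$, of the signs of the classical crossings between $D^i$ and $D^j$ whose overpass is on $D^i$. Its absolute value does not depend on the cut orientation or on the cut system $P$ of $D$, and is denoted $|\nu_D(i,j)|$. Coherent double covering with cut orientation. Place $(D,P)$ to the right of the $y$-axis with all crossings and points of $P=\{p_1,\dots,p_m\}$ having distinct $y$-coordinates, and let $(D^*,P^* )$ be a copy of $(D,P)$ to the left of the $y$-axis obtained by translation along the $x$-axis; $p_s^*$ is the copy of $p_s$. Let $l_s$ be the horizontal line through $p_s$ and $p_s^*$ (the strands being transverse to $l_s$). In a thin neighborhood $N(l_s)$ of each $l_s$, cut the strands at $p_s$ and $p_s^*$ and reconnect crosswise: the lower end at $p_s$ is joined to the upper end at $p_s^*$ and the lower end at $p_s^*$ to the upper end at $p_s$, by arcs inside $N(l_s)$, all newly created double points being virtual crossings. Give $D$ the cut orientation $\mathcal{O}_c(D,P)$ and give $D^*$ the cut orientation $\mathcal{O}_c(D^*,P^* )$ in which each arc is oriented oppositely to the corresponding arc of $D$; these induce a consistent orientation of the resulting diagram. The resulting oriented virtual link diagram is $\phi_{\mathcal{O}_c(D,P)}(D,P)$. It has $2r$ components; the part coming from $D^i$ and its copy consists of two components, denoted $D^i_1$ and $D^i_2$. *)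

theory Defs
  imports "HOL-Analysis.Analysis"
begin

section \<open>Virtual link diagrams\<close>

text \<open>
  The plane is the type of complex numbers. A closed 1-manifold is a finite family of circles,
  each of them given by a regular \<open>1\<close>-periodic parametrization; its points are the pairs
  \<open>(i, t)\<close> of a component and a parameter in \<open>{0..<1}\<close>. The parametrization is auxiliary: the
  diagram is unoriented, and orientations are recorded relative to it by signs.

  \<open>classical\<close> is the set of classical crossings. For such a crossing \<open>c\<close>, \<open>over c\<close> and \<open>under c\<close> are
  the two points of the 1-manifold that lie above \<open>c\<close>; the values elsewhere are irrelevant.
  The other double points are the virtual crossings.
\<close>

record 'c diagram =
  comps :: "'c set"
  curve :: "'c \<Rightarrow> real \<Rightarrow> complex"
  classical :: "complex set"
  over :: "complex \<Rightarrow> 'c \<times> real"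
  under :: "complex \<Rightarrow> 'c \<times> real"

definition points :: "'c diagram \<Rightarrow> ('c \<times> real) set" where
  "points D = comps D \<times> {0..<1}"

definition pos :: "'c diagram \<Rightarrow> 'c \<times> real \<Rightarrow> complex" where
  "pos D q = curve D (fst q) (snd q)"

definition vel :: "'c diagram \<Rightarrow> 'c \<times> real \<Rightarrow> complex" where
  "vel D q = vector_derivative (curve D (fst q)) (at (snd q))"

definition det2 :: "complex \<Rightarrow> complex \<Rightarrow> real" where
  "det2 u v = Re u * Im v - Im u * Re v"

definition double_points :: "'c diagram \<Rightarrow> complex set" where
  "double_points D = {z. \<exists>q\<in>points D. \<exists>q'\<in>points D. q \<noteq> q' \<and> pos D q = z \<and> pos D q' = z}"

definition virtual_link_diagram :: "'c diagram \<Rightarrow> bool" where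
  "virtual_link_diagram D \<longleftrightarrow>
     finite (comps D) \<and>
     (\<forall>i\<in>comps D. (\<forall>t. curve D i (t + 1) = curve D i t) \<and>
        curve D i C1_differentiable_on UNIV \<and> (\<forall>t. vel D (i, t) \<noteq> 0)) \<and>
     finite (double_points D) \<and>
     (\<forall>z\<in>double_points D. card {q \<in> points D. pos D q = z} = 2) \<and>
     (\<forall>q\<in>points D. \<forall>q'\<in>points D. q \<noteq> q' \<and> pos D q = pos D q' \<longrightarrow>
        det2 (vel D q) (vel D q') \<noteq> 0) \<and>
     classical D \<subseteq> double_points D \<and>
     (\<forall>c\<in>classical D. over D c \<noteq> under D c \<and>
        {q \<in> points D. pos D q = c} = {over D c, under D c})"

text \<open>A self-crossing of a component is passed twice by it, at two different parameters.\<close>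

definition even_diagram :: "'c diagram \<Rightarrow> bool" where
  "even_diagram D \<longleftrightarrow>
     (\<forall>i\<in>comps D. even (card {t \<in> {0..<1}. curve D i t \<in> classical D}))"


section \<open>Cut systems\<close>

definition edge_points :: "'c diagram \<Rightarrow> complex set \<Rightarrow> bool" where
  "edge_points D P \<longleftrightarrow> finite P \<and> P \<subseteq> pos D ` points D - double_points D"

text \<open>
  Colorings of the abstract link diagram. The complement of the core in the thickened surface is
  an open collar with two sides along each segment of the core between consecutive classical
  crossings and points of \<open>P\<close>. Here \<open>col i t True\<close> and \<open>col i t False\<close> are the colors of the
  regions immediately to the left and to the right of the core at \<open>(i, t)\<close> (left and right
  refer to the direction of the parametrization and to the plane; the values at classical
  crossings and at points of \<open>P\<close> carry no information). They are subject to: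

  \<^item> the two sides have different colors;
  \<^item> a region continues along a band, also at a virtual crossing, where the bands are disjoint;
  \<^item> the half twist at a point of \<open>P\<close> joins the left side before it to the right side after it
    and vice versa;
  \<^item> in the disk at a classical crossing with overpass velocity \<open>u\<close> and underpass velocity \<open>v\<close>,
    for all signs \<open>a\<close> and \<open>b\<close> the corner between the half-edges of directions \<open>a u\<close> and \<open>b v\<close>
    belongs to one region. It lies to the left of the overpass iff \<open>b v\<close> points to the left
    of \<open>u\<close>, and to the left of the underpass iff \<open>a u\<close> points to the left of \<open>v\<close>.
\<close>

definition checkerboard_coloring ::
    "'c diagram \<Rightarrow> complex set \<Rightarrow> ('c \<Rightarrow> real \<Rightarrow> bool \<Rightarrow> bool) \<Rightarrow> bool" where
  "checkerboard_coloring D P col \<longleftrightarrow>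
     (\<forall>i\<in>comps D. \<forall>t.
        (\<forall>side. col i (t + 1) side = col i t side) \<and>
        col i t True \<noteq> col i t False \<and>
        (curve D i t \<notin> classical D \<union> P \<longrightarrow>
           (\<forall>\<^sub>F s in nhds t. \<forall>side. col i s side = col i t side)) \<and>
        (curve D i t \<in> P \<longrightarrow>
           (\<forall>\<^sub>F h in at_right 0. \<forall>side. col i (t + h) side = col i (t - h) (\<not> side)))) \<and>
     (\<forall>c\<in>classical D. \<forall>i s j t. over D c = (i, s) \<and> under D c = (j, t) \<longrightarrow>
        (\<forall>a\<in>{1, -1}. \<forall>b\<in>{1, -1}. \<forall>\<^sub>F h in at_right 0.
           col i (s + a * h) (0 < det2 (vel D (i, s)) (b *\<^sub>R vel D (j, t))) =
           col j (t + b * h) (0 < det2 (vel D (j, t)) (a *\<^sub>R vel D (i, s)))))"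

definition cut_system :: "'c diagram \<Rightarrow> complex set \<Rightarrow> bool" where
  "cut_system D P \<longleftrightarrow> edge_points D P \<and> (\<exists>col. checkerboard_coloring D P col)"

text \<open>
  Equivalent description by alternate orientations; \<open>\<alpha> i t = 1\<close> means that the segment at
  \<open>(i, t)\<close> is oriented in the direction of the parametrization.
\<close>

definition alternate_orientation ::
    "'c diagram \<Rightarrow> complex set \<Rightarrow> ('c \<Rightarrow> real \<Rightarrow> real) \<Rightarrow> bool" where
  "alternate_orientation D P \<alpha> \<longleftrightarrow>
     (\<forall>i\<in>comps D. \<forall>t.
        \<alpha> i t \<in> {1, -1} \<and> \<alpha> i (t + 1) = \<alpha> i t \<and>
        (curve D i t \<notin> classical D \<union> P \<longrightarrow> (\<forall>\<^sub>F s in nhds t. \<alpha> i s = \<alpha> i t)) \<and>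
        (curve D i t \<in> P \<longrightarrow> (\<forall>\<^sub>F h in at_right 0. \<alpha> i (t + h) = - \<alpha> i (t - h)))) \<and>
     (\<forall>c\<in>classical D. \<forall>i s j t. over D c = (i, s) \<and> under D c = (j, t) \<longrightarrow>
        (\<forall>\<^sub>F h in at_right 0. \<alpha> i (s + h) = - \<alpha> i (s - h) \<and> \<alpha> j (t + h) = - \<alpha> j (t - h) \<and>
           \<alpha> i (s + h) = - \<alpha> j (t + h)))"

lemma cut_system_iff_alternate_orientation:
  assumes D: "virtual_link_diagram D"
  shows "cut_system D P \<longleftrightarrow> edge_points D P \<and> (\<exists>\<alpha>. alternate_orientation D P \<alpha>)"
proof -
  have sides: "det2 (vel D (i, s)) (vel D (j, t)) \<noteq> 0 \<and> i \<in> comps D \<and> j \<in> comps D"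
    if c: "c \<in> classical D" "over D c = (i, s)" "under D c = (j, t)" for c i s j t
  proof -
    have "{q \<in> points D. pos D q = c} = {(i, s), (j, t)}" "(i, s) \<noteq> (j, t)"
      using D c unfolding virtual_link_diagram_def by metis+
    then have "(i, s) \<in> points D \<and> pos D (i, s) = c" "(j, t) \<in> points D \<and> pos D (j, t) = c"
      by blast+
    then have "(i, s) \<in> points D" "(j, t) \<in> points D" "pos D (i, s) = pos D (j, t)"
      by simp_all
    then show ?thesis
      using D \<open>(i, s) \<noteq> (j, t)\<close> unfolding virtual_link_diagram_def points_def by blast
  qed
  have flip: "det2 v u = - det2 u v" "det2 u (- v) = - det2 u v" for u v
    by (simp_all add: det2_def)
  have "\<exists>\<alpha>. alternate_orientation D P \<alpha>" if col: "checkerboard_coloring D P col" for col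
  proof
    let ?\<alpha> = "\<lambda>i t. if col i t True then 1 else - 1 :: real"
    have other: "col i t False = (\<not> col i t True)" if "i \<in> comps D" for i t
      using col that unfolding checkerboard_coloring_def by blast
    show "alternate_orientation D P ?\<alpha>"
      unfolding alternate_orientation_def
    proof (intro conjI ballI allI impI)
      fix i t assume i: "i \<in> comps D"
      show "?\<alpha> i t \<in> {1, -1}" by simp
      show "?\<alpha> i (t + 1) = ?\<alpha> i t"
        using col i unfolding checkerboard_coloring_def by simp
      show "\<forall>\<^sub>F s in nhds t. ?\<alpha> i s = ?\<alpha> i t" if "curve D i t \<notin> classical D \<union> P"
      proof -
        have "\<forall>\<^sub>F s in nhds t. \<forall>side. col i s side = col i t side"
          using col i that unfolding checkerboard_coloring_def by blast
        then show ?thesis by eventually_elim simp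
      qed
      show "\<forall>\<^sub>F h in at_right 0. ?\<alpha> i (t + h) = - ?\<alpha> i (t - h)" if "curve D i t \<in> P"
      proof -
        have "\<forall>\<^sub>F h in at_right 0. \<forall>side. col i (t + h) side = col i (t - h) (\<not> side)"
          using col i that unfolding checkerboard_coloring_def by blast
        then show ?thesis by eventually_elim (simp add: other[OF i])
      qed
    next
      fix c i s j t
      assume c: "c \<in> classical D" and q: "over D c = (i, s) \<and> under D c = (j, t)"
      let ?u = "vel D (i, s)" and ?v = "vel D (j, t)"
      have ij: "i \<in> comps D" "j \<in> comps D" and nz: "det2 ?u ?v \<noteq> 0"
        using sides[of c i s j t] c q by auto
      have corner: "\<forall>\<^sub>F h in at_right 0. col i (s + a * h) (0 < det2 ?u (b *\<^sub>R ?v)) =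
          col j (t + b * h) (0 < det2 ?v (a *\<^sub>R ?u))" if "a \<in> {1, -1}" "b \<in> {1, -1}" for a b
        using col c q that unfolding checkerboard_coloring_def by blast
      show "\<forall>\<^sub>F h in at_right 0. ?\<alpha> i (s + h) = - ?\<alpha> i (s - h) \<and> ?\<alpha> j (t + h) = - ?\<alpha> j (t - h) \<and>
           ?\<alpha> i (s + h) = - ?\<alpha> j (t + h)"
        using corner[of 1 1, simplified] corner[of 1 "- 1", simplified]
          corner[of "- 1" 1, simplified] corner[of "- 1" "- 1", simplified]
      proof eventually_elim
        case (elim h)
        from nz have "0 < det2 ?u ?v \<or> det2 ?u ?v < 0" by linarith
        then show ?case
        proof
          assume "0 < det2 ?u ?v"
          then show ?thesis
            using elim by (simp add: flip(1)[of ?v ?u] flip(2) other[OF ij(1)] other[OF ij(2)])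
        next
          assume "det2 ?u ?v < 0"
          then show ?thesis
            using elim by (simp add: flip(1)[of ?v ?u] flip(2) other[OF ij(1)] other[OF ij(2)])
        qed
      qed
    qed
  qed
  moreover have "\<exists>col. checkerboard_coloring D P col" if al: "alternate_orientation D P \<alpha>" for \<alpha>
  proof
    let ?col = "\<lambda>i t side. side = (\<alpha> i t = 1)"
    have pm: "\<alpha> i t = 1 \<or> \<alpha> i t = - 1" if "i \<in> comps D" for i t
      using al that unfolding alternate_orientation_def by blast
    show "checkerboard_coloring D P ?col"
      unfolding checkerboard_coloring_def
    proof (intro conjI ballI allI impI)
      fix i t assume i: "i \<in> comps D"
      show "?col i (t + 1) side = ?col i t side" for side
        using al i unfolding alternate_orientation_def by simp
      show "?col i t True \<noteq> ?col i t False" by simp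
      show "\<forall>\<^sub>F s in nhds t. \<forall>side. ?col i s side = ?col i t side"
        if "curve D i t \<notin> classical D \<union> P"
      proof -
        have "\<forall>\<^sub>F s in nhds t. \<alpha> i s = \<alpha> i t"
          using al i that unfolding alternate_orientation_def by blast
        then show ?thesis by eventually_elim simp
      qed
      show "\<forall>\<^sub>F h in at_right 0. \<forall>side. ?col i (t + h) side = ?col i (t - h) (\<not> side)"
        if "curve D i t \<in> P"
      proof -
        have "\<forall>\<^sub>F h in at_right 0. \<alpha> i (t + h) = - \<alpha> i (t - h)"
          using al i that unfolding alternate_orientation_def by blast
        then show ?thesis
        proof eventually_elim
          case (elim h)
          then show ?case using pm[OF i, of "t - h"] by auto
        qed
      qed
    next
      fix c i s j t and a b :: real
      assume c: "c \<in> classical D" and q: "over D c = (i, s) \<and> under D c = (j, t)"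
        and ab: "a \<in> {1, -1}" "b \<in> {1, -1}"
      let ?u = "vel D (i, s)" and ?v = "vel D (j, t)"
      have ij: "i \<in> comps D" "j \<in> comps D" and nz: "det2 ?u ?v \<noteq> 0"
        using sides[of c i s j t] c q by auto
      have "\<forall>\<^sub>F h in at_right 0. \<alpha> i (s + h) = - \<alpha> i (s - h) \<and> \<alpha> j (t + h) = - \<alpha> j (t - h) \<and>
           \<alpha> i (s + h) = - \<alpha> j (t + h)"
        using al c q unfolding alternate_orientation_def by blast
      then show "\<forall>\<^sub>F h in at_right 0. ?col i (s + a * h) (0 < det2 ?u (b *\<^sub>R ?v)) =
          ?col j (t + b * h) (0 < det2 ?v (a *\<^sub>R ?u))"
      proof eventually_elim
        case (elim h)
        then have ends: "\<alpha> i (s - h) = - \<alpha> i (s + h)" "\<alpha> j (t - h) = \<alpha> i (s + h)"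
          "\<alpha> j (t + h) = - \<alpha> i (s + h)"
          by simp_all
        from ab have "a = 1 \<or> a = - 1" "b = 1 \<or> b = - 1" by simp_all
        moreover from pm[OF ij(1)] have "\<alpha> i (s + h) = 1 \<or> \<alpha> i (s + h) = - 1" .
        moreover from nz have "0 < det2 ?u ?v \<or> det2 ?u ?v < 0" by linarith
        ultimately show ?case
          by (elim disjE) (simp_all add: ends flip(1)[of ?v ?u] flip(2))
      qed
    qed
  qed
  ultimately show ?thesis unfolding cut_system_def by blast
qed


section \<open>Cut orientations and the invariant\<close>

text \<open>
  \<open>ori i t\<close> is the sign of the orientation at \<open>(i, t)\<close> relative to the parametrization; its values
  at the cut points carry no information. With \<open>P = {}\<close> this is an orientation of the diagram.
\<close>

definition cut_orientation ::
    "'c diagram \<Rightarrow> complex set \<Rightarrow> ('c \<Rightarrow> real \<Rightarrow> real) \<Rightarrow> bool" where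
  "cut_orientation D P ori \<longleftrightarrow>
     (\<forall>i\<in>comps D. \<forall>t.
        ori i t \<in> {1, -1} \<and> ori i (t + 1) = ori i t \<and>
        (curve D i t \<notin> P \<longrightarrow> (\<forall>\<^sub>F s in nhds t. ori i s = ori i t)) \<and>
        (curve D i t \<in> P \<longrightarrow> (\<forall>\<^sub>F h in at_right 0. ori i (t + h) = - ori i (t - h))))"

text \<open>A crossing is positive iff the underpass crosses the overpass from right to left.\<close>

definition crossing_sign :: "'c diagram \<Rightarrow> ('c \<Rightarrow> real \<Rightarrow> real) \<Rightarrow> complex \<Rightarrow> int" where
  "crossing_sign D ori c =
     (let (i, s) = over D c; (j, t) = under D c in
      if 0 < det2 (ori i s *\<^sub>R vel D (i, s)) (ori j t *\<^sub>R vel D (j, t)) then 1 else -1)"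

definition sign_sum ::
    "'c diagram \<Rightarrow> ('c \<Rightarrow> real \<Rightarrow> real) \<Rightarrow> 'c set \<Rightarrow> 'c set \<Rightarrow> int" where
  "sign_sum D ori A B =
     (\<Sum>c\<in>{c \<in> classical D. fst (over D c) \<in> A \<and> fst (under D c) \<in> B}. crossing_sign D ori c)"

definition nu :: "'c diagram \<Rightarrow> ('c \<Rightarrow> real \<Rightarrow> real) \<Rightarrow> 'c \<Rightarrow> 'c \<Rightarrow> int" where
  "nu D ori i j = sign_sum D ori {i} {j}"

text \<open>The common value for all cut systems and all cut orientations.\<close>

definition abs_nu :: "'c diagram \<Rightarrow> 'c \<Rightarrow> 'c \<Rightarrow> int" where
  "abs_nu D i j =
     (THE n. \<exists>P ori. cut_system D P \<and> cut_orientation D P ori \<and> n = \<bar>nu D ori i j\<bar>)"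


section \<open>Coherent double coverings\<close>

definition plane_diffeo :: "(complex \<Rightarrow> complex) \<Rightarrow> bool" where
  "plane_diffeo f \<longleftrightarrow> bij f \<and>
     (\<exists>f'. (\<forall>z. (f has_derivative f' z) (at z)) \<and> (\<forall>v. continuous_on UNIV (\<lambda>z. f' z v)) \<and>
           (\<forall>z. 0 < det2 (f' z 1) (f' z \<i>)))"

definition image_diagram :: "(complex \<Rightarrow> complex) \<Rightarrow> 'c diagram \<Rightarrow> 'c diagram" where
  "image_diagram f D =
     \<lparr>comps = comps D, curve = (\<lambda>i t. f (curve D i t)), classical = f ` classical D,
      over = (\<lambda>c. over D (inv f c)), under = (\<lambda>c. under D (inv f c))\<rparr>"

definition strip :: "real \<Rightarrow> complex \<Rightarrow> complex set" where
  "strip \<epsilon> p = {z. \<bar>Im z - Im p\<bar> \<le> \<epsilon>}"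

text \<open>
  Admissible position of \<open>(D, P)\<close>, the leftward translation by \<open>d\<close> producing the copy \<open>D\<^sup>*\<close>, and
  the thickness \<open>\<epsilon>\<close> of the strips \<open>N(l\<^sub>s)\<close>: all strands of the diagram are transverse to the
  horizontal direction inside the strips, and the strips are disjoint from each other and from
  the crossings.
\<close>

definition in_position :: "'c diagram \<Rightarrow> complex set \<Rightarrow> real \<Rightarrow> real \<Rightarrow> bool" where
  "in_position D P d \<epsilon> \<longleftrightarrow>
     (\<forall>q\<in>points D. 0 < Re (pos D q) \<and> Re (pos D q - of_real d) < 0) \<and>
     inj_on Im (double_points D \<union> P) \<and>
     0 < \<epsilon> \<and>
     (\<forall>p\<in>P. \<forall>p'\<in>P. p \<noteq> p' \<longrightarrow> strip \<epsilon> p \<inter> strip \<epsilon> p' = {}) \<and>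
     (\<forall>p\<in>P. strip \<epsilon> p \<inter> double_points D = {}) \<and>
     (\<forall>p\<in>P. \<forall>q\<in>points D. pos D q \<in> strip \<epsilon> p \<longrightarrow> Im (vel D q) \<noteq> 0)"

text \<open>
  For \<open>t\<close> in the window \<open>[a, b]\<close> the strand of the component \<open>i\<close> through the point \<open>p\<close> of \<open>P\<close>
  traverses the strip around \<open>p\<close> from one boundary line to the other.
\<close>

definition cut_window ::
    "'c diagram \<Rightarrow> real \<Rightarrow> 'c \<Rightarrow> complex \<Rightarrow> real \<Rightarrow> real \<Rightarrow> bool" where
  "cut_window D \<epsilon> i p a b \<longleftrightarrow>
     a < b \<and> curve D i ` {a..b} \<subseteq> strip \<epsilon> p \<and> p \<in> curve D i ` {a..b} \<and>
     {Im (curve D i a), Im (curve D i b)} = {Im p - \<epsilon>, Im p + \<epsilon>}"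

text \<open>
  \<open>E\<close> arises from the diagram \<open>D\<close> in admissible position and its copy by reconnecting crosswise
  at \<open>P\<close>. The components of \<open>E\<close> coming from the component \<open>i\<close> of \<open>D\<close> and its copy are \<open>(i, 1)\<close>
  and \<open>(i, 2)\<close>, numbered arbitrarily and carrying the parametrization of the component \<open>i\<close>.
  Outside the windows they run, one each, along \<open>D\<close> and its copy; in a window they run inside
  the strip, and an end of the strand at \<open>p\<close> is joined to the opposite end of the copied strand.
  The shape of the new arcs is not prescribed beyond \<open>E\<close> being a diagram. The classical crossings of
  \<open>E\<close> are those of \<open>D\<close> and of the copy, so all other double points of \<open>E\<close> are virtual.
\<close>

definition crosswise_reconnection ::
    "'c diagram \<Rightarrow> complex set \<Rightarrow> real \<Rightarrow> real \<Rightarrow> ('c \<times> nat) diagram \<Rightarrow> bool" where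
  "crosswise_reconnection D P d \<epsilon> E \<longleftrightarrow>
     virtual_link_diagram E \<and>
     comps E = comps D \<times> {1, 2} \<and>
     (\<forall>i\<in>comps D. \<forall>t. (\<nexists>p a b. p \<in> P \<and> cut_window D \<epsilon> i p a b \<and> a < t \<and> t < b) \<longrightarrow>
        {curve E (i, 1) t, curve E (i, 2) t} = {curve D i t, curve D i t - of_real d}) \<and>
     (\<forall>i\<in>comps D. \<forall>p\<in>P. \<forall>a b. cut_window D \<epsilon> i p a b \<longrightarrow>
        (\<forall>k\<in>{1, 2}. curve E (i, k) ` {a..b} \<subseteq> strip \<epsilon> p \<and>
           (curve E (i, k) a = curve D i a \<longleftrightarrow> curve E (i, k) b = curve D i b - of_real d))) \<and>
     classical E = classical D \<union> (\<lambda>c. c - of_real d) ` classical D \<and>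
     (\<forall>c\<in>classical D. \<forall>x\<in>{c, c - of_real d}.
        (\<exists>k\<in>{1, 2}. over E x = ((fst (over D c), k), snd (over D c))) \<and>
        (\<exists>k\<in>{1, 2}. under E x = ((fst (under D c), k), snd (under D c))))"

text \<open>The cut orientation of \<open>D\<close> on \<open>D\<close>, the opposite one on the copy.\<close>

definition induced_orientation ::
    "'c diagram \<Rightarrow> complex set \<Rightarrow> real \<Rightarrow> real \<Rightarrow> ('c \<Rightarrow> real \<Rightarrow> real) \<Rightarrow>
     ('c \<times> nat) diagram \<Rightarrow> ('c \<times> nat \<Rightarrow> real \<Rightarrow> real) \<Rightarrow> bool" where
  "induced_orientation D P d \<epsilon> ori E oriE \<longleftrightarrow>
     cut_orientation E {} oriE \<and>
     (\<forall>i\<in>comps D. \<forall>k\<in>{1, 2}. \<forall>t.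
        (\<nexists>p a b. p \<in> P \<and> cut_window D \<epsilon> i p a b \<and> a < t \<and> t < b) \<longrightarrow>
        (curve E (i, k) t = curve D i t \<longrightarrow> oriE (i, k) t = ori i t) \<and>
        (curve E (i, k) t = curve D i t - of_real d \<longrightarrow> oriE (i, k) t = - ori i t))"

text \<open>
  \<open>(D, P)\<close> is first moved into admissible position by an orientation preserving diffeomorphism
  \<open>f\<close> of the plane; since parameters are unchanged, so are the signs \<open>ori\<close>.
  The relation holds for every \<open>(E, oriE)\<close> obtained by some choices of position, thickness and arcs.
\<close>

definition coherent_double_covering ::
    "'c diagram \<Rightarrow> complex set \<Rightarrow> ('c \<Rightarrow> real \<Rightarrow> real) \<Rightarrow>
     ('c \<times> nat) diagram \<Rightarrow> ('c \<times> nat \<Rightarrow> real \<Rightarrow> real) \<Rightarrow> bool" where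
  "coherent_double_covering D P ori E oriE \<longleftrightarrow>
     (\<exists>f d \<epsilon>. plane_diffeo f \<and>
        in_position (image_diagram f D) (f ` P) d \<epsilon> \<and>
        crosswise_reconnection (image_diagram f D) (f ` P) d \<epsilon> E \<and>
        induced_orientation (image_diagram f D) (f ` P) d \<epsilon> ori E oriE)"

end

theory Submission
  imports Defs
begin

text \<open>
  The left-hand side is in fact \<open>\<bar>nu D ori i j\<bar>\<close> for the given cut orientation, before any
  absolute value is taken. Each crossing \<open>c\<close> of \<open>D\<close> has two lifts, one on the moved diagram and one
  on its translated copy. Above the overpass of \<open>c\<close> the components \<open>(i, 1)\<close> and \<open>(i, 2)\<close> run one
  each along the diagram and the copy, so exactly one of the two lifts has its overpass on
  \<open>(i, k)\<close>. Since the strips around the cuts avoid the crossings, both strands at a lift are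
  translates of the strands at the moved crossing \<open>f c\<close>, with orientations both preserved on the diagram and both reversed on the copy. The sign is the same in
  either case, and an orientation preserving diffeomorphism of the plane does not affect it
  (\<open>lifted_crossing\<close>). Summation over the crossings gives \<open>sign_sum_eq_nu\<close>.

  It remains to see that \<open>\<bar>nu D ori i j\<bar>\<close> is the same for all cut systems and cut orientations.
  A cut system carries an alternate orientation \<open>\<alpha>\<close>, which switches exactly at the cut points and at
  the classical crossings, whereas \<open>ori\<close> switches exactly at the cut points. The product
  \<open>ori * \<alpha>\<close> thus switches exactly at the classical crossings, so it no longer remembers the cut
  system: on each component it is determined up to one global sign
  (\<open>orientation_products_proportional\<close>). At a crossing of two strands the alternate orientations of
  the two ends just after the crossing are opposite, so the product of the two values of \<open>ori\<close>,
  on which the sign of the crossing depends, is minus the product of the two values of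
  \<open>ori * \<alpha>\<close> there. Passing to
  other data therefore multiplies all signs of the crossings of components \<open>i\<close> and \<open>j\<close> by one
  common sign (\<open>abs_nu_cut_independent\<close>).
\<close>

section \<open>Functions that are constant off a discrete set\<close>

lemma symmetric_near:
  fixes g :: "real \<Rightarrow> 'a"
  assumes "\<forall>\<^sub>F s in nhds t. g s = g t"
  shows "\<forall>\<^sub>F h in at_right 0. g (t + h) = g (t - h)"
proof -
  obtain e where e: "e > 0" "\<And>s. dist s t < e \<Longrightarrow> g s = g t"
    using assms unfolding eventually_nhds_metric by blast
  have "g (t + h) = g (t - h)" if "0 < h" "h < e" for h
    using e(2)[of "t + h"] e(2)[of "t - h"] that by (simp add: dist_real_def)
  then show ?thesis
    unfolding eventually_at_right_field using e(1) by blast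
qed

lemma eventually_right_of:
  fixes t :: real
  assumes "\<forall>\<^sub>F s in at t. Q s"
  shows "\<forall>\<^sub>F h in at_right 0. Q (t + h)"
proof -
  obtain e where e: "e > 0" "\<And>s. s \<noteq> t \<Longrightarrow> dist s t < e \<Longrightarrow> Q s"
    using assms unfolding eventually_at by blast
  have "Q (t + h)" if "0 < h" "h < e" for h
    using e(2)[of "t + h"] that by (simp add: dist_real_def)
  then show ?thesis
    unfolding eventually_at_right_field using e(1) by blast
qed

lemma periodic_of_int:
  fixes g :: "real \<Rightarrow> 'a"
  assumes "\<And>t. g (t + 1) = g t"
  shows "g (t + of_int n) = g t"
proof (induction n rule: int_induct[where k = 0])
  case (step1 n)
  then show ?case using assms[of "t + of_int n"] by (simp add: add.assoc)
next
  case (step2 n)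
  then show ?case using assms[of "t + of_int (n - 1)"] by simp
qed simp

text \<open>
  A locally constant function has a left and a right limit at each point of \<open>S\<close>, and \<open>match\<close> makes
  them equal. So the function that takes these limits as values is locally constant on the whole
  line, hence constant. The values of \<open>g\<close> on \<open>S\<close> itself are arbitrary, as are
  those of orientations at cut points.
\<close>

lemma constant_off_discrete:
  fixes g :: "real \<Rightarrow> 'a"
  assumes discrete: "\<And>t. \<forall>\<^sub>F s in at t. s \<notin> S"
    and const: "\<And>t. t \<notin> S \<Longrightarrow> \<forall>\<^sub>F s in nhds t. g s = g t"
    and match: "\<And>t. t \<in> S \<Longrightarrow> \<forall>\<^sub>F h in at_right 0. g (t + h) = g (t - h)"
  shows "\<exists>c. \<forall>t. t \<notin> S \<longrightarrow> g t = c"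
proof -
  have interval: "g x = g y"
    if "connected A" "A \<inter> S = {}" "x \<in> A" "y \<in> A" for A x y
  proof (rule connected_local_const[OF that(1,3,4)], rule ballI)
    fix a assume "a \<in> A"
    with that have "\<forall>\<^sub>F b in nhds a. g b = g a" by (intro const) auto
    then show "\<forall>\<^sub>F b in at a within A. g a = g b"
      unfolding eventually_at_filter by eventually_elim auto
  qed
  have "\<exists>c. \<forall>\<^sub>F s in at t. g s = c" for t
  proof -
    \<comment> \<open>a two-sided limit at \<open>t\<close>: both sides are constant, and agree at one pair \<open>t + h\<close>, \<open>t - h\<close>\<close>
    obtain \<delta> where \<delta>: "\<delta> > 0" "\<And>s. s \<noteq> t \<Longrightarrow> dist s t < \<delta> \<Longrightarrow> s \<notin> S"
      using discrete[of t] unfolding eventually_at by blast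
    have "\<forall>\<^sub>F h in at_right 0. g (t + h) = g (t - h)"
    proof (cases "t \<in> S")
      case False
      then show ?thesis by (intro symmetric_near const)
    qed (rule match)
    then obtain e where e: "e > 0" "\<And>h. 0 < h \<Longrightarrow> h < e \<Longrightarrow> g (t + h) = g (t - h)"
      unfolding eventually_at_right_field by blast
    define h where "h = min \<delta> e / 2"
    have h: "0 < h" "h < \<delta>" "h < e" using \<delta>(1) e(1) by (auto simp: h_def)
    have right: "g s = g (t + h)" if "t < s" "s < t + \<delta>" for s
      by (rule interval[of "{t<..<t+\<delta>}"]) (use that h \<delta>(2) in \<open>auto simp: dist_real_def\<close>)
    have left: "g s = g (t - h)" if "t - \<delta> < s" "s < t" for s
      by (rule interval[of "{t-\<delta><..<t}"]) (use that h \<delta>(2) in \<open>auto simp: dist_real_def\<close>)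
    have "g s = g (t + h)" if "s \<noteq> t" "dist s t < \<delta>" for s
    proof (cases "t < s")
      case True
      with right[of s] that show ?thesis by (auto simp: dist_real_def)
    next
      case False
      with left[of s] that e(2)[of h] h show ?thesis by (auto simp: dist_real_def)
    qed
    then show ?thesis using \<delta>(1) unfolding eventually_at by blast
  qed
  then obtain c where c: "\<And>t. \<forall>\<^sub>F s in at t. g s = c t" by metis
  have "c a = c b" for a b
  proof (rule connected_local_const[of UNIV], simp_all, rule allI)
    fix a
    have "\<forall>\<^sub>F s in nhds a. \<forall>\<^sub>F r in nhds s. r \<noteq> a \<longrightarrow> g r = c a"
      using c[of a] unfolding eventually_at_filter eventually_eventually by simp
    then show "\<forall>\<^sub>F b in at a. c a = c b"
      unfolding eventually_at_filter
    proof (eventually_elim, intro impI)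
      fix s assume s: "\<forall>\<^sub>F r in nhds s. r \<noteq> a \<longrightarrow> g r = c a" and "s \<noteq> a" "s \<in> UNIV"
      have "\<forall>\<^sub>F r in at s. r \<noteq> a \<longrightarrow> g r = c a"
        using s unfolding eventually_at_filter by eventually_elim simp
      moreover have "\<forall>\<^sub>F r in at s. r \<noteq> a"
        using \<open>s \<noteq> a\<close> by (intro eventually_neq_at_within)
      ultimately have "\<forall>\<^sub>F r in at s. c a = c s"
        using c[of s] by eventually_elim simp
      then show "c a = c s" by simp
    qed
  qed
  moreover have "g t = c t" if "t \<notin> S" for t
  proof -
    have "\<forall>\<^sub>F s in at t. g s = g t"
      using const[OF that] unfolding eventually_at_filter by eventually_elim simp
    with c[of t] have "\<forall>\<^sub>F s in at t. g t = c t" by eventually_elim simp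
    then show ?thesis by simp
  qed
  ultimately have "g t = c 0" if "t \<notin> S" for t using that by simp
  then show ?thesis by blast
qed


section \<open>Curves and crossings of a diagram\<close>

lemma regular_curve:
  assumes D: "virtual_link_diagram D" and i: "i \<in> comps D"
  shows "curve D i C1_differentiable_on UNIV" "vel D (i, t) \<noteq> 0"
proof -
  have "\<forall>i\<in>comps D. (\<forall>t. curve D i (t + 1) = curve D i t) \<and>
      curve D i C1_differentiable_on UNIV \<and> (\<forall>t. vel D (i, t) \<noteq> 0)"
    using D unfolding virtual_link_diagram_def by (elim conjE)
  from bspec[OF this i] show "curve D i C1_differentiable_on UNIV" "vel D (i, t) \<noteq> 0"
    by (elim conjE; simp)+
qed

lemma curve_has_velocity:
  assumes "virtual_link_diagram D" "i \<in> comps D"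
  shows "(curve D i has_vector_derivative vel D (i, t)) (at t)"
proof -
  obtain f' where "\<And>x. (curve D i has_vector_derivative f' x) (at x)"
    using regular_curve(1)[OF assms] unfolding C1_differentiable_on_def by auto
  then have "curve D i differentiable at t"
    by (meson differentiableI_vector)
  then show ?thesis by (simp add: vel_def vector_derivative_works)
qed

text \<open>
  A regular curve is locally injective: if the curve returned to its value at times \<open>s\<close> arbitrarily
  near to \<open>t\<close>, the remainder of the first-order expansion would be \<open>- (s - t)\<close> times the
  nonzero velocity, hence not of smaller order than \<open>s - t\<close>.
\<close>

lemma curve_avoids_finite_set:
  assumes D: "virtual_link_diagram D" "i \<in> comps D" and "finite Z"
  shows "\<forall>\<^sub>F s in at t. curve D i s \<notin> Z"
proof -
  note der = curve_has_velocity[OF D, of t]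
  have "\<forall>\<^sub>F s in at t. curve D i s \<noteq> z" for z
  proof (cases "curve D i t = z")
    case True
    let ?v = "vel D (i, t)"
    have "((\<lambda>s. (1 / norm (s - t)) *\<^sub>R (curve D i s - (curve D i t + (s - t) *\<^sub>R ?v))) \<longlongrightarrow> 0) (at t)"
      using der unfolding has_vector_derivative_def has_derivative_within by blast
    moreover have "?v \<noteq> 0"
      by (rule regular_curve(2)[OF D])
    ultimately have "\<forall>\<^sub>F s in at t.
        norm ((1 / norm (s - t)) *\<^sub>R (curve D i s - (curve D i t + (s - t) *\<^sub>R ?v))) < norm ?v"
      unfolding tendsto_iff dist_norm by simp
    moreover have "\<forall>\<^sub>F s in at t. s \<noteq> t"
      by (intro eventually_neq_at_within)
    ultimately show ?thesis
    proof eventually_elim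
      case (elim s)
      then have less: "norm (curve D i s - (curve D i t + (s - t) *\<^sub>R ?v)) < \<bar>s - t\<bar> * norm ?v"
        unfolding norm_scaleR by (simp add: pos_divide_less_eq mult.commute)
      show "curve D i s \<noteq> z"
      proof
        assume "curve D i s = z"
        then have "curve D i s - (curve D i t + (s - t) *\<^sub>R ?v) = - ((s - t) *\<^sub>R ?v)"
          using True by simp
        then show False using less by simp
      qed
    qed
  next
    case False
    have "isCont (curve D i) t"
      by (rule has_vector_derivative_continuous[OF der])
    then show ?thesis
      unfolding isCont_def using False by (intro tendsto_imp_eventually_ne)
  qed
  then have "\<forall>\<^sub>F s in at t. \<forall>z\<in>Z. curve D i s \<noteq> z"
    using \<open>finite Z\<close> by (intro eventually_ball_finite) auto
  then show ?thesis by eventually_elim blast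
qed

lemma classical_crossing:
  assumes D: "virtual_link_diagram D" and c: "c \<in> classical D"
    and q: "over D c = (i, s)" "under D c = (j, t)"
  shows "i \<in> comps D" "j \<in> comps D" "curve D i s = c" "curve D j t = c"
    "det2 (vel D (i, s)) (vel D (j, t)) \<noteq> 0" "(i, s) \<in> points D" "(j, t) \<in> points D"
proof -
  have "over D c \<noteq> under D c \<and> {q \<in> points D. pos D q = c} = {over D c, under D c}"
    using D c unfolding virtual_link_diagram_def by blast
  then have "{q \<in> points D. pos D q = c} = {(i, s), (j, t)}" and ne: "(i, s) \<noteq> (j, t)"
    using q by simp_all
  then have q': "(i, s) \<in> points D \<and> pos D (i, s) = c" "(j, t) \<in> points D \<and> pos D (j, t) = c"
    by blast+
  then show "i \<in> comps D" "j \<in> comps D" "curve D i s = c" "curve D j t = c"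
    "(i, s) \<in> points D" "(j, t) \<in> points D"
    by (auto simp: points_def pos_def)
  have transverse: "\<forall>q\<in>points D. \<forall>q'\<in>points D. q \<noteq> q' \<and> pos D q = pos D q' \<longrightarrow>
        det2 (vel D q) (vel D q') \<noteq> 0"
    using D unfolding virtual_link_diagram_def by (elim conjE)
  from q' have "(i, s) \<in> points D" "(j, t) \<in> points D" "pos D (i, s) = pos D (j, t)" by simp_all
  then show "det2 (vel D (i, s)) (vel D (j, t)) \<noteq> 0"
    using transverse ne by blast
qed

lemma finite_classical:
  "virtual_link_diagram D \<Longrightarrow> finite (classical D)"
  unfolding virtual_link_diagram_def by (elim conjE) (rule finite_subset)

lemma det2_scaleR: "det2 (a *\<^sub>R u) (b *\<^sub>R v) = a * b * det2 u v"
  by (simp add: det2_def algebra_simps)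

lemma classical_subset: "virtual_link_diagram D \<Longrightarrow> classical D \<subseteq> double_points D"
  unfolding virtual_link_diagram_def by (elim conjE)

lemma curve_periodic:
  assumes "virtual_link_diagram D" "i \<in> comps D"
  shows "curve D i (t + of_int n) = curve D i t"
proof (rule periodic_of_int)
  show "curve D i (t + 1) = curve D i t" for t
    using assms unfolding virtual_link_diagram_def by (elim conjE) simp
qed

text \<open>
  The points above a crossing have parameters in \<open>{0..<1}\<close>, while orientations are functions of all
  real parameters.
\<close>

lemma classical_parameter:
  assumes D: "virtual_link_diagram D" and i: "i \<in> comps D" and c: "curve D i t \<in> classical D"
  obtains n :: int where "over D (curve D i t) = (i, t + of_int n) \<or>
    under D (curve D i t) = (i, t + of_int n)"
proof -
  let ?n = "- \<lfloor>t\<rfloor>" and ?c = "curve D i t"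
  have "{q \<in> points D. pos D q = ?c} = {over D ?c, under D ?c}"
    using D c unfolding virtual_link_diagram_def by (elim conjE) simp
  moreover have "(i, t + of_int ?n) \<in> points D"
    using i by (simp add: points_def) linarith
  moreover have "pos D (i, t + of_int ?n) = ?c"
    unfolding pos_def fst_conv snd_conv by (rule curve_periodic[OF D i])
  ultimately have "(i, t + of_int ?n) \<in> {over D ?c, under D ?c}" by blast
  with that[of ?n] show thesis by auto
qed


section \<open>Independence of the cut system and of the cut orientation\<close>

lemma cut_orientationD:
  assumes "cut_orientation D P ori" "i \<in> comps D"
  shows "ori i t \<in> {1, -1}" "ori i (t + of_int n) = ori i t"
    "curve D i t \<notin> P \<Longrightarrow> \<forall>\<^sub>F s in nhds t. ori i s = ori i t"
    "curve D i t \<in> P \<Longrightarrow> \<forall>\<^sub>F h in at_right 0. ori i (t + h) = - ori i (t - h)"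
proof -
  note * = assms(1)[unfolded cut_orientation_def, THEN bspec, OF assms(2), THEN spec]
  show "ori i t \<in> {1, -1}"
    "curve D i t \<notin> P \<Longrightarrow> \<forall>\<^sub>F s in nhds t. ori i s = ori i t"
    "curve D i t \<in> P \<Longrightarrow> \<forall>\<^sub>F h in at_right 0. ori i (t + h) = - ori i (t - h)"
    using *[of t] by simp_all
  show "ori i (t + of_int n) = ori i t"
    by (rule periodic_of_int) (rule *[THEN conjunct2, THEN conjunct1])
qed

lemma alternate_orientationD:
  assumes "alternate_orientation D P \<alpha>" "i \<in> comps D"
  shows "\<alpha> i t \<in> {1, -1}" "\<alpha> i (t + of_int n) = \<alpha> i t"
    "curve D i t \<notin> classical D \<union> P \<Longrightarrow> \<forall>\<^sub>F s in nhds t. \<alpha> i s = \<alpha> i t"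
    "curve D i t \<in> P \<Longrightarrow> \<forall>\<^sub>F h in at_right 0. \<alpha> i (t + h) = - \<alpha> i (t - h)"
proof -
  note * = assms(1)[unfolded alternate_orientation_def, THEN conjunct1, THEN bspec,
      OF assms(2), THEN spec]
  show "\<alpha> i t \<in> {1, -1}"
    "curve D i t \<notin> classical D \<union> P \<Longrightarrow> \<forall>\<^sub>F s in nhds t. \<alpha> i s = \<alpha> i t"
    "curve D i t \<in> P \<Longrightarrow> \<forall>\<^sub>F h in at_right 0. \<alpha> i (t + h) = - \<alpha> i (t - h)"
    using *[of t] by simp_all
  show "\<alpha> i (t + of_int n) = \<alpha> i t"
    by (rule periodic_of_int) (rule *[THEN conjunct2, THEN conjunct1])
qed

lemma alternate_orientation_crossing:
  assumes "alternate_orientation D P \<alpha>" "c \<in> classical D"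
    "over D c = (i, s)" "under D c = (j, t)"
  shows "\<forall>\<^sub>F h in at_right 0. \<alpha> i (s + h) = - \<alpha> i (s - h) \<and> \<alpha> j (t + h) = - \<alpha> j (t - h) \<and>
           \<alpha> i (s + h) = - \<alpha> j (t + h)"
  using assms(1)[unfolded alternate_orientation_def, THEN conjunct2, THEN bspec, OF assms(2)]
    assms(3,4) by simp

text \<open>At a cut point both factors switch, so their product does not.\<close>

lemma orientation_product_off_crossings:
  assumes i: "i \<in> comps D"
    and \<alpha>: "alternate_orientation D P \<alpha>" and o: "cut_orientation D P ori"
    and t: "curve D i t \<notin> classical D"
  shows "curve D i t \<notin> P \<Longrightarrow> \<forall>\<^sub>F s in nhds t. ori i s * \<alpha> i s = ori i t * \<alpha> i t"
    and "\<forall>\<^sub>F h in at_right 0. ori i (t + h) * \<alpha> i (t + h) = ori i (t - h) * \<alpha> i (t - h)"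
proof -
  show const: "\<forall>\<^sub>F s in nhds t. ori i s * \<alpha> i s = ori i t * \<alpha> i t" if "curve D i t \<notin> P"
    using cut_orientationD(3)[OF o i that] alternate_orientationD(3)[OF \<alpha> i, of t] that t
    by (auto elim: eventually_elim2)
  show "\<forall>\<^sub>F h in at_right 0. ori i (t + h) * \<alpha> i (t + h) = ori i (t - h) * \<alpha> i (t - h)"
  proof (cases "curve D i t \<in> P")
    case True
    from cut_orientationD(4)[OF o i True] alternate_orientationD(4)[OF \<alpha> i True]
    show ?thesis by eventually_elim simp
  qed (rule symmetric_near[OF const])
qed

text \<open>
  The strands of the diagram keep the orientation \<open>ori\<close> through the crossing, so the switches of the
  product are those of \<open>\<alpha>\<close>. The first claim is the source of the invariance: it expresses the
  sign-determining product of the values of \<open>ori\<close> by the products \<open>ori * \<alpha>\<close>. The minus sign is there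
  because under \<open>\<alpha>\<close> one strand has both its ends directed into the crossing, the other both
  out of it.
\<close>

lemma orientation_product_at_crossing:
  assumes D: "virtual_link_diagram D" and P: "edge_points D P"
    and \<alpha>: "alternate_orientation D P \<alpha>" and o: "cut_orientation D P ori"
    and c: "c \<in> classical D" and q: "over D c = (i, s)" "under D c = (j, t)"
  shows "\<forall>\<^sub>F h in at_right 0. (ori i (s + h) * \<alpha> i (s + h)) * (ori j (t + h) * \<alpha> j (t + h)) =
      - (ori i s * ori j t)"
    and "\<forall>\<^sub>F h in at_right 0. ori i (s + h) * \<alpha> i (s + h) = - (ori i (s - h) * \<alpha> i (s - h))"
    and "\<forall>\<^sub>F h in at_right 0. ori j (t + h) * \<alpha> j (t + h) = - (ori j (t - h) * \<alpha> j (t - h))"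
proof -
  note cc = classical_crossing[OF D c q]
  have "c \<notin> P"
    using P c classical_subset[OF D] unfolding edge_points_def by blast
  then have "\<forall>\<^sub>F r in nhds s. ori i r = ori i s" "\<forall>\<^sub>F r in nhds t. ori j r = ori j t"
    using cut_orientationD(3)[OF o cc(1), of s] cut_orientationD(3)[OF o cc(2), of t] cc(3,4)
    by simp_all
  then have sym: "\<forall>\<^sub>F h in at_right 0. ori i (s + h) = ori i (s - h)"
    "\<forall>\<^sub>F h in at_right 0. ori j (t + h) = ori j (t - h)"
    and near: "\<forall>\<^sub>F h in at_right 0. ori i (s + h) = ori i s"
    "\<forall>\<^sub>F h in at_right 0. ori j (t + h) = ori j t"
    by (auto simp: eventually_nhds_conv_at intro!: symmetric_near dest: eventually_right_of)
  note alt = alternate_orientation_crossing[OF \<alpha> c q]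
  from near alt
  show "\<forall>\<^sub>F h in at_right 0. (ori i (s + h) * \<alpha> i (s + h)) * (ori j (t + h) * \<alpha> j (t + h)) =
      - (ori i s * ori j t)"
  proof eventually_elim
    case (elim h)
    then show ?case using alternate_orientationD(1)[OF \<alpha> cc(2), of "t + h"] by auto
  qed
  from sym(1) alt
  show "\<forall>\<^sub>F h in at_right 0. ori i (s + h) * \<alpha> i (s + h) = - (ori i (s - h) * \<alpha> i (s - h))"
    by eventually_elim simp
  from sym(2) alt
  show "\<forall>\<^sub>F h in at_right 0. ori j (t + h) * \<alpha> j (t + h) = - (ori j (t - h) * \<alpha> j (t - h))"
    by eventually_elim simp
qed

lemma orientation_product_flips:
  assumes D: "virtual_link_diagram D" and i: "i \<in> comps D" and P: "edge_points D P"
    and \<alpha>: "alternate_orientation D P \<alpha>" and o: "cut_orientation D P ori"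
    and c: "curve D i t \<in> classical D"
  shows "\<forall>\<^sub>F h in at_right 0. ori i (t + h) * \<alpha> i (t + h) = - (ori i (t - h) * \<alpha> i (t - h))"
proof -
  let ?c = "curve D i t"
  obtain n :: int where "over D ?c = (i, t + of_int n) \<or> under D ?c = (i, t + of_int n)"
    using classical_parameter[OF D i c] .
  then have "\<forall>\<^sub>F h in at_right 0. ori i (t + of_int n + h) * \<alpha> i (t + of_int n + h) =
      - (ori i (t + of_int n - h) * \<alpha> i (t + of_int n - h))"
  proof
    assume q: "over D ?c = (i, t + of_int n)"
    obtain j r where "under D ?c = (j, r)" by fastforce
    from orientation_product_at_crossing(2)[OF D P \<alpha> o c q this] show ?thesis .
  next
    assume q: "under D ?c = (i, t + of_int n)"
    obtain j r where "over D ?c = (j, r)" by fastforce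
    from orientation_product_at_crossing(3)[OF D P \<alpha> o c this q] show ?thesis .
  qed
  moreover have "t + of_int n + h = t + h + of_int n" "t + of_int n - h = t - h + of_int n" for h
    by simp_all
  ultimately show ?thesis
    by (simp only: cut_orientationD(2)[OF o i] alternate_orientationD(2)[OF \<alpha> i])
qed

text \<open>
  The two products switch at the same places, the classical crossings, so their quotient extends to a
  constant function on the component. As all values are \<open>1\<close> or \<open>-1\<close>, the quotient is again
  a product.
\<close>

lemma orientation_products_proportional:
  assumes D: "virtual_link_diagram D" and i: "i \<in> comps D"
    and P: "edge_points D P" "alternate_orientation D P \<alpha>" "cut_orientation D P ori"
    and P': "edge_points D P'" "alternate_orientation D P' \<alpha>'" "cut_orientation D P' ori'"
  obtains e :: real where "e \<in> {1, -1}" "\<And>t. curve D i t \<notin> classical D \<union> P \<union> P' \<Longrightarrow>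
    ori' i t * \<alpha>' i t = e * (ori i t * \<alpha> i t)"
proof -
  let ?S = "{t. curve D i t \<in> classical D \<union> P \<union> P'}"
  define g where "g t = (ori i t * \<alpha> i t) * (ori' i t * \<alpha>' i t)" for t
  have discrete: "\<forall>\<^sub>F s in at t. s \<notin> ?S" for t
    using curve_avoids_finite_set[OF D i, of "classical D \<union> P \<union> P'" t]
      finite_classical[OF D] P(1) P'(1)
    unfolding edge_points_def by simp
  have "\<exists>e. \<forall>t. t \<notin> ?S \<longrightarrow> g t = e"
  proof (rule constant_off_discrete[OF discrete])
    fix t assume "t \<notin> ?S"
    then have "\<forall>\<^sub>F s in nhds t. ori i s * \<alpha> i s = ori i t * \<alpha> i t"
      "\<forall>\<^sub>F s in nhds t. ori' i s * \<alpha>' i s = ori' i t * \<alpha>' i t"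
      using orientation_product_off_crossings(1)[OF i P(2,3)]
        orientation_product_off_crossings(1)[OF i P'(2,3)] by simp_all
    then show "\<forall>\<^sub>F s in nhds t. g s = g t"
      by eventually_elim (simp add: g_def)
  next
    fix t
    show "\<forall>\<^sub>F h in at_right 0. g (t + h) = g (t - h)"
    proof (cases "curve D i t \<in> classical D")
      case True
      from orientation_product_flips[OF D i P True] orientation_product_flips[OF D i P' True]
      show ?thesis by eventually_elim (simp add: g_def)
    next
      case False
      from orientation_product_off_crossings(2)[OF i P(2,3) False]
        orientation_product_off_crossings(2)[OF i P'(2,3) False]
      show ?thesis by eventually_elim (simp add: g_def)
    qed
  qed
  then obtain e where e: "\<And>t. t \<notin> ?S \<Longrightarrow> g t = e" by blast
  have units: "ori i t \<in> {1, -1}" "\<alpha> i t \<in> {1, -1}" "ori' i t \<in> {1, -1}" "\<alpha>' i t \<in> {1, -1}" for t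
    using cut_orientationD(1)[OF P(3) i] alternate_orientationD(1)[OF P(2) i]
      cut_orientationD(1)[OF P'(3) i] alternate_orientationD(1)[OF P'(2) i] by blast+
  obtain t where "t \<notin> ?S"
    using eventually_happens'[OF _ discrete[of 0]] by auto
  with e[of t] have "e = g t" by simp
  also have "g t \<in> {1, -1}"
    using units[of t] by (auto simp: g_def)
  finally have "e \<in> {1, -1}" .
  moreover have "ori' i t * \<alpha>' i t = e * (ori i t * \<alpha> i t)"
    if "curve D i t \<notin> classical D \<union> P \<union> P'" for t
    using e[of t] that units[of t] by (auto simp: g_def)
  ultimately show thesis by (rule that)
qed

lemma crossing_sign_eq:
  assumes "over D c = (i, s)" "under D c = (j, t)"
  shows "crossing_sign D ori c =
    (if 0 < ori i s * ori j t * det2 (vel D (i, s)) (vel D (j, t)) then 1 else -1)"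
  using assms by (simp add: crossing_sign_def det2_scaleR)

text \<open>
  Both orientations are compared at a point slightly after the crossing, which is off all cut points
  and crossings; the factors \<open>a\<close> and \<open>b\<close> there depend on the components alone.
\<close>

lemma abs_nu_cut_independent:
  assumes D: "virtual_link_diagram D" and ij: "i \<in> comps D" "j \<in> comps D"
    and P: "cut_system D P" "cut_orientation D P ori"
    and P': "cut_system D P'" "cut_orientation D P' ori'"
  shows "\<bar>nu D ori' i j\<bar> = \<bar>nu D ori i j\<bar>"
proof -
  obtain \<alpha> \<alpha>' where \<alpha>: "edge_points D P" "alternate_orientation D P \<alpha>"
    and \<alpha>': "edge_points D P'" "alternate_orientation D P' \<alpha>'"
    using P(1) P'(1) cut_system_iff_alternate_orientation[OF D] by metis
  let ?Z = "classical D \<union> P \<union> P'"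
  have fin: "finite ?Z"
    using finite_classical[OF D] \<alpha>(1) \<alpha>'(1) unfolding edge_points_def by simp
  obtain a where a: "a \<in> {1, -1}"
    "\<And>t. curve D i t \<notin> ?Z \<Longrightarrow> ori' i t * \<alpha>' i t = a * (ori i t * \<alpha> i t)"
    by (rule orientation_products_proportional[OF D ij(1) \<alpha> P(2) \<alpha>' P'(2)]) blast
  obtain b where b: "b \<in> {1, -1}"
    "\<And>t. curve D j t \<notin> ?Z \<Longrightarrow> ori' j t * \<alpha>' j t = b * (ori j t * \<alpha> j t)"
    by (rule orientation_products_proportional[OF D ij(2) \<alpha> P(2) \<alpha>' P'(2)]) blast
  define A where "A = {c \<in> classical D. fst (over D c) \<in> {i} \<and> fst (under D c) \<in> {j}}"
  define e :: int where "e = (if a * b = 1 then 1 else -1)"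
  have sign: "crossing_sign D ori' c = e * crossing_sign D ori c" if "c \<in> A" for c
  proof -
    define s t where "s = snd (over D c)" and "t = snd (under D c)"
    then have c: "c \<in> classical D" and q: "over D c = (i, s)" "under D c = (j, t)"
      using that by (simp_all add: A_def prod_eq_iff)
    note off = curve_avoids_finite_set[OF D _ fin, THEN eventually_right_of]
    have "\<forall>\<^sub>F h in at_right (0::real). ori' i s * ori' j t = a * b * (ori i s * ori j t)"
      using off[OF ij(1), of s] off[OF ij(2), of t]
        orientation_product_at_crossing(1)[OF D \<alpha> P(2) c q]
        orientation_product_at_crossing(1)[OF D \<alpha>' P'(2) c q]
    proof eventually_elim
      case (elim h)
      from elim(3,4) show ?case
        unfolding a(2)[OF elim(1)] b(2)[OF elim(2)] by (simp add: algebra_simps)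
    qed
    then have *: "ori' i s * ori' j t = a * b * (ori i s * ori j t)" by simp
    moreover have "det2 (vel D (i, s)) (vel D (j, t)) \<noteq> 0" "ori i s \<in> {1, -1}" "ori j t \<in> {1, -1}"
      using classical_crossing(5)[OF D c q] cut_orientationD(1)[OF P(2)] ij by blast+
    ultimately show ?thesis
      unfolding crossing_sign_eq[OF q] * e_def using a(1) b(1) by auto
  qed
  have "nu D ori' i j = e * nu D ori i j"
    unfolding nu_def sign_sum_def A_def[symmetric] sum_distrib_left
    by (rule sum.cong[OF refl sign])
  then show ?thesis by (simp add: e_def abs_mult)
qed

lemma abs_nu_eq:
  assumes "virtual_link_diagram D" "i \<in> comps D" "j \<in> comps D"
    and "cut_system D P" "cut_orientation D P ori"
  shows "abs_nu D i j = \<bar>nu D ori i j\<bar>"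
  unfolding abs_nu_def
proof (rule the_equality)
  show "\<exists>P ori'. cut_system D P \<and> cut_orientation D P ori' \<and> \<bar>nu D ori i j\<bar> = \<bar>nu D ori' i j\<bar>"
    using assms(4,5) by blast
next
  fix n assume "\<exists>P ori. cut_system D P \<and> cut_orientation D P ori \<and> n = \<bar>nu D ori i j\<bar>"
  then show "n = \<bar>nu D ori i j\<bar>"
    using abs_nu_cut_independent[OF assms(1-3)] assms(4,5) by metis
qed


section \<open>Crossings of a coherent double covering\<close>

lemma det2_linear:
  assumes "linear L"
  shows "det2 (L u) (L v) = det2 (L 1) (L \<i>) * det2 u v"
proof -
  have "L z = Re z *\<^sub>R L 1 + Im z *\<^sub>R L \<i>" for z
  proof -
    have "z = Re z *\<^sub>R 1 + Im z *\<^sub>R \<i>" by (simp add: complex_eq_iff)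
    then have "L z = L (Re z *\<^sub>R 1 + Im z *\<^sub>R \<i>)" by simp
    then show ?thesis by (simp only: linear_add[OF assms] linear_scale[OF assms])
  qed
  from this[of u] this[of v] show ?thesis
    by (simp add: det2_def algebra_simps)
qed

text \<open>
  A coherent double covering together with the choices made for it. The derivative \<open>df\<close> is fixed
  as well, since it carries the velocities of \<open>D\<close> to those of the moved diagram.
\<close>

locale placed_covering =
  fixes D :: "'c diagram" and P :: "complex set" and ori :: "'c \<Rightarrow> real \<Rightarrow> real"
    and E :: "('c \<times> nat) diagram" and oriE :: "'c \<times> nat \<Rightarrow> real \<Rightarrow> real"
    and f :: "complex \<Rightarrow> complex" and df :: "complex \<Rightarrow> complex \<Rightarrow> complex" and d \<epsilon> :: real
  assumes diagram: "virtual_link_diagram D"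
    and finite_cuts: "finite P"
    and inj_f: "inj f"
    and df: "\<And>z. (f has_derivative df z) (at z)"
    and df_positive: "\<And>z. 0 < det2 (df z 1) (df z \<i>)"
    and position: "in_position (image_diagram f D) (f ` P) d \<epsilon>"
    and reconnection: "crosswise_reconnection (image_diagram f D) (f ` P) d \<epsilon> E"
    and induced: "induced_orientation (image_diagram f D) (f ` P) d \<epsilon> ori E oriE"
begin

abbreviation G :: "'c diagram" where "G \<equiv> image_diagram f D"

lemma G_simps [simp]:
  "comps G = comps D" "curve G i t = f (curve D i t)" "classical G = f ` classical D"
  "points G = points D" "pos G q = f (pos D q)" "over G (f c) = over D c" "under G (f c) = under D c"
  by (simp_all add: image_diagram_def points_def pos_def inv_f_f[OF inj_f])

lemma curve_G_has_velocity:
  assumes "i \<in> comps D"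
  shows "(curve G i has_vector_derivative df (curve D i t) (vel D (i, t))) (at t)"
    and "vel G (i, t) = df (curve D i t) (vel D (i, t))"
proof -
  have "(f \<circ> curve D i has_vector_derivative df (curve D i t) (vel D (i, t))) (at t)"
    by (rule vector_derivative_diff_chain_within
        [OF curve_has_velocity[OF diagram assms] has_derivative_at_withinI[OF df]])
  then show *: "(curve G i has_vector_derivative df (curve D i t) (vel D (i, t))) (at t)"
    by (simp add: image_diagram_def o_def)
  show "vel G (i, t) = df (curve D i t) (vel D (i, t))"
    using vector_derivative_at[OF *] by (simp add: vel_def)
qed

lemma E_diagram: "virtual_link_diagram E"
  and comps_E: "comps E = comps D \<times> {1, 2}"
  and classical_E: "classical E = f ` classical D \<union> (\<lambda>c. c - of_real d) ` f ` classical D"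
  using reconnection unfolding crosswise_reconnection_def by simp_all

lemma sides_of_axis:
  assumes "(i, s) \<in> points D"
  shows "0 < Re (f (curve D i s))" "Re (f (curve D i s) - of_real d) < 0"
proof -
  have "\<forall>q\<in>points G. 0 < Re (pos G q) \<and> Re (pos G q - of_real d) < 0"
    using position unfolding in_position_def by (elim conjE)
  from bspec[OF this, of "(i, s)"] assms
  show "0 < Re (f (curve D i s))" "Re (f (curve D i s) - of_real d) < 0"
    by (simp_all add: pos_def)
qed

lemma crossing_off_strips:
  assumes "c \<in> classical D" "p \<in> f ` P"
  shows "f c \<notin> strip \<epsilon> p"
proof -
  have "\<forall>p\<in>f ` P. strip \<epsilon> p \<inter> double_points G = {}"
    using position unfolding in_position_def by (elim conjE)
  moreover have "f c \<in> double_points G"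
  proof -
    have "c \<in> double_points D" using classical_subset[OF diagram] assms(1) by blast
    then obtain q q' where "q \<in> points D" "q' \<in> points D" "q \<noteq> q'" "pos D q = c" "pos D q' = c"
      unfolding double_points_def by blast
    then show ?thesis
      unfolding double_points_def by (intro CollectI bexI[of _ q] bexI[of _ q']) simp_all
  qed
  ultimately show ?thesis using assms(2) by blast
qed

text \<open>
  A crossing is off the closed strips, and so are all nearby points of the strand. There the
  two components of the covering lie on the diagram and on its copy, and a component cannot jump
  between these, because they are separated by the vertical axis. So near the crossing it coincides
  with the strand or with its translate, and has the same velocity.
\<close>

lemma strand_near_crossing:
  assumes i: "i \<in> comps D" and k: "k \<in> {1, 2}" and s: "(i, s) \<in> points D"
    and c: "curve D i s \<in> classical D"
  shows "{curve E (i, 1) s, curve E (i, 2) s} = {curve G i s, curve G i s - of_real d}"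
    and "curve E (i, k) s = curve G i s \<Longrightarrow>
      oriE (i, k) s = ori i s \<and> vel E ((i, k), s) = vel G (i, s)"
    and "curve E (i, k) s = curve G i s - of_real d \<Longrightarrow>
      oriE (i, k) s = - ori i s \<and> vel E ((i, k), s) = vel G (i, s)"
proof -
  let ?free_at = "\<lambda>t. \<nexists>p a b. p \<in> f ` P \<and> cut_window G \<epsilon> i p a b \<and> a < t \<and> t < b"
  note der = curve_G_has_velocity(1)[OF i, of s]
  have contG: "(curve G i \<longlongrightarrow> curve G i s) (at s)"
    using has_vector_derivative_continuous[OF der] by (simp only: isCont_def)
  have ik: "(i, k) \<in> comps E" using i k by (simp add: comps_E)
  have contE: "(curve E (i, k) \<longlongrightarrow> curve E (i, k) s) (at s)"
    using has_vector_derivative_continuous[OF curve_has_velocity[OF E_diagram ik]]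
    by (simp only: isCont_def)
  have free: "?free_at t" if "\<forall>p\<in>f ` P. curve G i t \<notin> strip \<epsilon> p" for t
  proof
    assume "\<exists>p a b. p \<in> f ` P \<and> cut_window G \<epsilon> i p a b \<and> a < t \<and> t < b"
    then obtain p a b where p: "p \<in> f ` P" and w: "cut_window G \<epsilon> i p a b" and "a < t" "t < b"
      by blast
    then have "curve G i t \<in> curve G i ` {a..b}" by auto
    moreover have "curve G i ` {a..b} \<subseteq> strip \<epsilon> p"
      using w unfolding cut_window_def by (elim conjE)
    ultimately show False using that p by blast
  qed
  have off: "\<forall>p\<in>f ` P. curve G i s \<notin> strip \<epsilon> p"
    using crossing_off_strips[OF c] by simp
  have "\<forall>\<^sub>F t in at s. \<forall>p\<in>f ` P. curve G i t \<notin> strip \<epsilon> p"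
  proof (intro eventually_ball_finite ballI)
    fix p assume "p \<in> f ` P"
    then have "\<epsilon> < \<bar>Im (curve G i s) - Im p\<bar>" using off by (auto simp: strip_def)
    moreover have "((\<lambda>t. \<bar>Im (curve G i t) - Im p\<bar>) \<longlongrightarrow> \<bar>Im (curve G i s) - Im p\<bar>) (at s)"
      by (intro tendsto_intros contG)
    ultimately have "\<forall>\<^sub>F t in at s. \<epsilon> < \<bar>Im (curve G i t) - Im p\<bar>"
      by (rule order_tendstoD(1)[rotated])
    then show "\<forall>\<^sub>F t in at s. curve G i t \<notin> strip \<epsilon> p"
      by eventually_elim (simp add: strip_def)
  qed (use finite_cuts in simp)
  then have free_near: "\<forall>\<^sub>F t in at s. ?free_at t"
    by eventually_elim (rule free)
  have free_s: "?free_at s" by (rule free[OF off])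
  have pair: "{curve E (i, 1) t, curve E (i, 2) t} = {curve G i t, curve G i t - of_real d}"
    if "?free_at t" for t
  proof -
    have "\<forall>i\<in>comps G. \<forall>t. (\<nexists>p a b. p \<in> f ` P \<and> cut_window G \<epsilon> i p a b \<and> a < t \<and> t < b) \<longrightarrow>
        {curve E (i, 1) t, curve E (i, 2) t} = {curve G i t, curve G i t - of_real d}"
      using reconnection unfolding crosswise_reconnection_def by (elim conjE)
    from this[THEN bspec, of i, THEN spec, THEN mp, OF _ that] i show ?thesis by simp
  qed
  show "{curve E (i, 1) s, curve E (i, 2) s} = {curve G i s, curve G i s - of_real d}"
    by (rule pair[OF free_s])
  have two: "\<forall>\<^sub>F t in at s. curve E (i, k) t = curve G i t \<or>
      curve E (i, k) t = curve G i t - of_real d"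
    using free_near
  proof eventually_elim
    case (elim t)
    have "curve E (i, k) t \<in> {curve E (i, 1) t, curve E (i, 2) t}" using k by auto
    then show ?case unfolding pair[OF elim] by simp
  qed
  have orients: "(curve E (i, k) s = curve G i s \<longrightarrow> oriE (i, k) s = ori i s) \<and>
        (curve E (i, k) s = curve G i s - of_real d \<longrightarrow> oriE (i, k) s = - ori i s)"
  proof -
    have "\<forall>i\<in>comps G. \<forall>k\<in>{1, 2}. \<forall>t.
        (\<nexists>p a b. p \<in> f ` P \<and> cut_window G \<epsilon> i p a b \<and> a < t \<and> t < b) \<longrightarrow>
        (curve E (i, k) t = curve G i t \<longrightarrow> oriE (i, k) t = ori i t) \<and>
        (curve E (i, k) t = curve G i t - of_real d \<longrightarrow> oriE (i, k) t = - ori i t)"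
      using induced unfolding induced_orientation_def by (elim conjE)
    from this[THEN bspec, of i, THEN bspec, OF _ k, THEN spec, THEN mp, OF _ free_s] i
    show ?thesis by simp
  qed
  have axis: "0 < Re (curve G i s)" "Re (curve G i s) - d < 0"
    using sides_of_axis[OF s] by simp_all
  have near_axis: "\<forall>\<^sub>F t in at s. 0 < Re (curve G i t)" "\<forall>\<^sub>F t in at s. Re (curve G i t) - d < 0"
    by (rule order_tendstoD[OF _ axis(1)] order_tendstoD[OF _ axis(2)]; intro tendsto_intros contG)+
  \<comment> \<open>for \<open>x = 0\<close> on the diagram and for \<open>x = d\<close> on the copy\<close>
  have velocity: "vel E ((i, k), s) = vel G (i, s)"
    if "\<forall>\<^sub>F t in at s. curve E (i, k) t = curve G i t - of_real x"
      and "curve E (i, k) s = curve G i s - of_real x" for x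
  proof -
    have "vel E ((i, k), s) = vector_derivative (\<lambda>t. curve G i t - of_real x) (at s)"
      unfolding vel_def fst_conv snd_conv
      by (rule vector_derivative_cong_eq) (use that in \<open>simp_all add: eventually_nhds_conv_at\<close>)
    also have "\<dots> = df (curve D i s) (vel D (i, s))"
      by (rule vector_derivative_at)
        (use has_vector_derivative_diff[OF der has_vector_derivative_const] in simp)
    finally show ?thesis by (simp only: curve_G_has_velocity(2)[OF i])
  qed
  show "oriE (i, k) s = ori i s \<and> vel E ((i, k), s) = vel G (i, s)"
    if e: "curve E (i, k) s = curve G i s"
  proof -
    have "\<forall>\<^sub>F t in at s. 0 < Re (curve E (i, k) t)"
      by (rule order_tendstoD(1)[OF tendsto_Re[OF contE]]) (use axis e in simp)
    with two near_axis(2) have "\<forall>\<^sub>F t in at s. curve E (i, k) t = curve G i t - of_real 0"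
      by eventually_elim auto
    from velocity[OF this] e orients show ?thesis by simp
  qed
  show "oriE (i, k) s = - ori i s \<and> vel E ((i, k), s) = vel G (i, s)"
    if e: "curve E (i, k) s = curve G i s - of_real d"
  proof -
    have "\<forall>\<^sub>F t in at s. Re (curve E (i, k) t) < 0"
      by (rule order_tendstoD(2)[OF tendsto_Re[OF contE]]) (use axis e in simp)
    with two near_axis(1) have "\<forall>\<^sub>F t in at s. curve E (i, k) t = curve G i t - of_real d"
      by eventually_elim auto
    from velocity[OF this e] e orients show ?thesis by simp
  qed
qed

text \<open>
  On the copy both strands are oriented oppositely, which leaves the sign of the crossing unchanged.
\<close>

lemma lifted_crossing:
  assumes c: "c \<in> classical D" and q: "over D c = (i, s)" "under D c = (j, t)"
    and x: "x \<in> {f c, f c - of_real d}"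
  obtains k k' where "k \<in> {1, 2}" "k' \<in> {1, 2}"
    "over E x = ((i, k), s)" "under E x = ((j, k'), t)"
    "curve E (i, k) s = x" "crossing_sign E oriE x = crossing_sign D ori c"
proof -
  note cc = classical_crossing[OF diagram c q]
  have "\<forall>c\<in>classical G. \<forall>x\<in>{c, c - of_real d}.
        (\<exists>k\<in>{1, 2}. over E x = ((fst (over G c), k), snd (over G c))) \<and>
        (\<exists>k\<in>{1, 2}. under E x = ((fst (under G c), k), snd (under G c)))"
    using reconnection unfolding crosswise_reconnection_def by (elim conjE)
  from this[THEN bspec, of "f c", THEN bspec, OF _ x] c q
  obtain k k' where k: "k \<in> {1, 2}" "k' \<in> {1, 2}"
    and Eq: "over E x = ((i, k), s)" "under E x = ((j, k'), t)"
    by auto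
  have "x \<in> classical E" using x c by (auto simp: classical_E)
  note Ec = classical_crossing[OF E_diagram this Eq]
  note strand1 = strand_near_crossing[OF cc(1) k(1) cc(6), unfolded G_simps cc(3), OF c]
    and strand2 = strand_near_crossing[OF cc(2) k(2) cc(7), unfolded G_simps cc(4), OF c]
  have vels: "vel E ((i, k), s) = df c (vel D (i, s))" "vel E ((j, k'), t) = df c (vel D (j, t))"
    using x strand1(2,3) strand2(2,3) Ec(3,4) cc(3,4)
    by (auto simp: curve_G_has_velocity(2)[OF cc(1)] curve_G_has_velocity(2)[OF cc(2)])
  have oris: "oriE (i, k) s * oriE (j, k') t = ori i s * ori j t"
    using x strand1(2,3) strand2(2,3) Ec(3,4) by auto
  have "linear (df c)" using df[of c] by (rule has_derivative_linear)
  then have "det2 (vel E ((i, k), s)) (vel E ((j, k'), t)) =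
      det2 (df c 1) (df c \<i>) * det2 (vel D (i, s)) (vel D (j, t))"
    unfolding vels by (rule det2_linear)
  moreover have "(0 < r * (det2 (df c 1) (df c \<i>) * y)) = (0 < r * y)" for r y
    using mult_less_cancel_left_pos[OF df_positive, of c 0 "r * y"]
    by (simp only: mult_zero_right mult.left_commute[of r])
  ultimately have "crossing_sign E oriE x = crossing_sign D ori c"
    unfolding crossing_sign_eq[OF q] crossing_sign_eq[OF Eq] oris by simp
  with that k Eq Ec(3) show thesis by blast
qed

text \<open>
  The lift of a crossing \<open>c\<close> on the prescribed component \<open>(i, k)\<close> is the point of that component at
  the parameter of the overpass of \<open>c\<close>. This is a bijection onto the crossings summed on the left:
  the copy is on the other side of the vertical axis, so lifts of different crossings differ.
\<close>

lemma sign_sum_eq_nu: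
  assumes ij: "i \<in> comps D" "j \<in> comps D" and k: "k \<in> {1, 2}"
  shows "sign_sum E oriE {(i, k)} {(j, 1), (j, 2)} = nu D ori i j"
proof -
  define A where "A = {c \<in> classical D. fst (over D c) \<in> {i} \<and> fst (under D c) \<in> {j}}"
  define B where "B = {x \<in> classical E. fst (over E x) \<in> {(i, k)} \<and>
    fst (under E x) \<in> {(j, 1), (j, 2)}}"
  define lift where "lift c = curve E (i, k) (snd (over D c))" for c
  have A: "c \<in> classical D" "over D c = (i, snd (over D c))" "under D c = (j, snd (under D c))"
    if "c \<in> A" for c
    using that by (simp_all add: A_def prod_eq_iff)
  have axis: "0 < Re (f c)" "Re (f c) - d < 0" if c: "c \<in> A" for c
    using sides_of_axis[OF classical_crossing(6)[OF diagram A[OF c]]]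
      classical_crossing(3)[OF diagram A[OF c]] by simp_all
  have fibre: "{curve E (i, 1) (snd (over D c)), curve E (i, 2) (snd (over D c))} =
      {f c, f c - of_real d}" if c: "c \<in> A" for c
    using strand_near_crossing(1)[OF ij(1) k classical_crossing(6)[OF diagram A[OF c]]]
      classical_crossing(3)[OF diagram A[OF c]] A(1)[OF c] by simp
  have lift_in: "lift c \<in> {f c, f c - of_real d}" if c: "c \<in> A" for c
    unfolding fibre[OF c, symmetric] lift_def using k by auto
  have lifted: "lift c \<in> B \<and> crossing_sign E oriE (lift c) = crossing_sign D ori c"
    if c: "c \<in> A" for c
  proof -
    obtain k1 k2 where k1: "k1 \<in> {1, 2}" "k2 \<in> {1, 2}"
      "over E (lift c) = ((i, k1), snd (over D c))" "under E (lift c) = ((j, k2), snd (under D c))"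
      "curve E (i, k1) (snd (over D c)) = lift c"
      and sign: "crossing_sign E oriE (lift c) = crossing_sign D ori c"
      by (rule lifted_crossing[OF A[OF c] lift_in[OF c]]) blast
    \<comment> \<open>the two lifts differ, so the parameter of the overpass determines the component from the lift\<close>
    have "f c \<noteq> f c - of_real d" using axis[OF c] by (auto simp: complex_eq_iff)
    then have "curve E (i, 1) (snd (over D c)) \<noteq> curve E (i, 2) (snd (over D c))"
      using fibre[OF c] by auto
    then have "k1 = k"
      using k k1(1,5) unfolding lift_def by auto
    moreover have "lift c \<in> classical E"
      using lift_in[OF c] A(1)[OF c] by (auto simp: classical_E)
    ultimately show ?thesis using k1 sign by (auto simp: B_def)
  qed
  have "B \<subseteq> lift ` A"
  proof
    fix x assume "x \<in> B"
    then have x: "x \<in> classical E" "fst (over E x) = (i, k)" "fst (under E x) \<in> {(j, 1), (j, 2)}"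
      by (simp_all add: B_def)
    then obtain c where c: "c \<in> classical D" "x \<in> {f c, f c - of_real d}"
      by (auto simp: classical_E)
    obtain i' s j' t where q: "over D c = (i', s)" "under D c = (j', t)" by fastforce
    obtain k1 k2 where "over E x = ((i', k1), s)" "under E x = ((j', k2), t)"
      "curve E (i', k1) s = x"
      by (rule lifted_crossing[OF c(1) q c(2)]) blast
    with x q c(1) show "x \<in> lift ` A"
      by (intro image_eqI[of _ _ c]) (auto simp: lift_def A_def)
  qed
  moreover have "lift ` A \<subseteq> B" using lifted by blast
  moreover have "inj_on lift A"
  proof
    fix c c' assume c: "c \<in> A" "c' \<in> A" "lift c = lift c'"
    then have "f c = f c'"
      using lift_in[OF c(1)] lift_in[OF c(2)] axis[OF c(1)] axis[OF c(2)]
      by (auto simp: complex_eq_iff)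
    then show "c = c'" by (rule injD[OF inj_f])
  qed
  ultimately have "bij_betw lift A B" by (simp add: bij_betw_def)
  from sum.reindex_bij_betw[OF this, of "crossing_sign E oriE"] lifted
  show ?thesis
    unfolding nu_def sign_sum_def A_def[symmetric] B_def[symmetric] by simp
qed

end


section \<open>Absolute sign sums in the covering\<close>

theorem theorem19:
  fixes D :: "nat diagram" and r :: nat and P :: "complex set"
    and ori :: "nat \<Rightarrow> real \<Rightarrow> real"
    and E :: "(nat \<times> nat) diagram" and oriE :: "nat \<times> nat \<Rightarrow> real \<Rightarrow> real"
    and i j k :: nat
  assumes "virtual_link_diagram D" and "comps D = {1..r}" and "even_diagram D"
    and "cut_system D P" and "cut_orientation D P ori"
    and "coherent_double_covering D P ori E oriE"
    and "i \<in> {1..r}" and "j \<in> {1..r}" and "i \<noteq> j" and "k \<in> {1, 2}"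
  shows "\<bar>sign_sum E oriE {(i, k)} {(j, 1), (j, 2)}\<bar> = abs_nu D i j"
proof -
  have ij: "i \<in> comps D" "j \<in> comps D" using assms(2,7,8) by simp_all
  have "finite P" using assms(4) unfolding cut_system_def edge_points_def by simp
  obtain f d \<epsilon> where f: "plane_diffeo f"
    and E: "in_position (image_diagram f D) (f ` P) d \<epsilon>"
      "crosswise_reconnection (image_diagram f D) (f ` P) d \<epsilon> E"
      "induced_orientation (image_diagram f D) (f ` P) d \<epsilon> ori E oriE"
    using assms(6) unfolding coherent_double_covering_def by (elim exE conjE)
  have "\<exists>df. (\<forall>z. (f has_derivative df z) (at z)) \<and>
      (\<forall>v. continuous_on UNIV (\<lambda>z. df z v)) \<and> (\<forall>z. 0 < det2 (df z 1) (df z \<i>))"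
    using f unfolding plane_diffeo_def by (elim conjE)
  then obtain df where df: "\<And>z. (f has_derivative df z) (at z)"
    "\<And>z. 0 < det2 (df z 1) (df z \<i>)"
    by (elim exE conjE) (rule that; erule spec)
  have "inj f" using f unfolding plane_diffeo_def by (elim conjE) (rule bij_is_inj)
  then have "placed_covering D P ori E oriE f df d \<epsilon>"
    using assms(1) \<open>finite P\<close> df E by (intro placed_covering.intro)
  from placed_covering.sign_sum_eq_nu[OF this ij assms(10)]
  show ?thesis using abs_nu_eq[OF assms(1) ij assms(4,5)] by simp
qed

end
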